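(* Let $m\ge1$, and let $n=2m-2$ if $m$ is odd and $n=2m-3$ if $m$ is even. Let $\tilde z$ be an $m$-closed discrete holomorphic function (in rotated coordinates) such that $\tilde z_{i,0}=0$ for all $i\in2\mathbb Z$. Assume that the propagation map $T$ can be applied to $(\tilde z_0,\tilde z_1)$ at least $n$ times. Then, for all $i\in\mathbb Z$ such that $i+n+1$ is even, $$\tilde z_{i,n+1}=\Bigl(\frac1m\sum_{\ell=0}^{m-1}\frac{1}{\tilde z_{2\ell+1,1}}\Bigr)^{-1}.$$ In other words, $\tilde z_{n+1}$ is constant with value equal to the harmonic mean of $\tilde z_1$.
   Context: $\hat{\mathbb C}=\mathbb C\cup\{\infty\}$ is identified with $\mathbb{CP}^1$. A discrete holomorphic function is a map $z$ to $\hat{\mathbb C}$ such that on every quad $\frac{(z_{i,j}-z_{i+1,j})(z_{i+1,j+1}-z_{i,j+1})}{(z_{i+1,j}-z_{i+1,j+1})(z_{i,j+1}-z_{i,j})}=-1$. Rotated coordinates: $z_{i,j}=\tilde z_{i-j,i+j}$, so $\tilde z_{i,j}$ is defined for $i+j$ even, and $\tilde z_j=(\tilde z_{i,j})_{i\equiv j\bmod 2}$. The relation determines $\tilde z_{j+2}$ from $(\tilde z_j,\tilde z_{j+1})$; the propagation map is $T:(\tilde z_j,\tilde z_{j+1})\mapsto(\tilde z_{j+1},\tilde z_{j+2})$. $z$ is $m$-closed if $z_{i+m,j-m}=z_{i,j}$ for all $i,j$, equivalently $\tilde z_{i+2m,j}=\tilde z_{i,j}$. Since $\tilde z_0$ is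 constant, backward propagation is undefined; $z$ is considered on $\{i+j\ge0\}$, obtained from $(\tilde z_0,\tilde z_1)$ by forward propagation. "$T$ can be applied" means that at each step the new values are well defined; standing assumption: the data are as generic as possible given the initial singularity. *)

theory Defs
  imports "HOL-Analysis.Analysis"
begin

section \<open>The Riemann sphere\<close>

datatype csphere = Pt complex | Infty

text \<open>
  The sphere gets the usual arithmetic of $\mathbb C\cup\{\infty\}$. The operations
  \<open>\<infinity> + \<infinity>\<close> and \<open>0 * \<infinity>\<close> have no mathematical meaning; they are given the value
  \<open>Infty\<close> to make the operations total (and addition associative). The instances
  serve only to write harmonic means, with \<open>1/0 = \<infinity>\<close> and \<open>1/\<infinity> = 0\<close>.
\<close>

instantiation csphere :: comm_monoid_add
begin

definition zero_csphere :: csphere where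
  "0 = Pt 0"

fun plus_csphere :: "csphere \<Rightarrow> csphere \<Rightarrow> csphere" where
  "Pt a + Pt b = Pt (a + b)"
| "Infty + y = Infty"
| "x + Infty = Infty"

instance
proof
  fix a b c :: csphere
  show "a + b + c = a + (b + c)"
    by (cases a; cases b; cases c) (simp_all add: add.assoc)
  show "a + b = b + a"
    by (cases a; cases b) (simp_all add: add.commute)
  show "0 + a = a"
    by (cases a) (simp_all add: zero_csphere_def)
qed

end

instantiation csphere :: "{times, inverse}"
begin

fun times_csphere :: "csphere \<Rightarrow> csphere \<Rightarrow> csphere" where
  "Pt a * Pt b = Pt (a * b)"
| "Infty * y = Infty"
| "x * Infty = Infty"

fun inverse_csphere :: "csphere \<Rightarrow> csphere" where
  "inverse (Pt a) = (if a = 0 then Infty else Pt (inverse a))"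
| "inverse Infty = Pt 0"

definition divide_csphere :: "csphere \<Rightarrow> csphere \<Rightarrow> csphere" where
  "x div y = x * inverse (y :: csphere)"

instance ..

end

section \<open>Discrete holomorphic functions\<close>

text \<open>
  Homogeneous coordinates under $\hat{\mathbb C} = \mathbb{CP}^1$. For finite points
  \<open>bracket (Pt a) (Pt b) = a - b\<close>. In the quotient \<open>cross_ratio\<close> the choice of lifts cancels,
  which makes sense of the cross-ratio when one of the points is infinite.
\<close>

fun hcoords :: "csphere \<Rightarrow> complex \<times> complex" where
  "hcoords (Pt a) = (a, 1)"
| "hcoords Infty = (1, 0)"

definition bracket :: "csphere \<Rightarrow> csphere \<Rightarrow> complex" where
  "bracket a b = fst (hcoords a) * snd (hcoords b) - fst (hcoords b) * snd (hcoords a)"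

text \<open>
  This is $\frac{(a-b)(c-d)}{(b-c)(d-a)}$. If the denominator vanishes, HOL division returns 0, so
  \<open>cross_ratio a b c d = -1\<close> includes that the denominator does not vanish. (It then even forces
  the four points to be pairwise distinct.)
\<close>

definition cross_ratio :: "csphere \<Rightarrow> csphere \<Rightarrow> csphere \<Rightarrow> csphere \<Rightarrow> complex" where
  "cross_ratio a b c d = (bracket a b * bracket c d) / (bracket b c * bracket d a)"

text \<open>Functions on a part \<open>R\<close> of the lattice: the condition is imposed on the quads within \<open>R\<close>.\<close>

definition discrete_holomorphic_on :: "(int \<times> int) set \<Rightarrow> (int \<Rightarrow> int \<Rightarrow> csphere) \<Rightarrow> bool" where
  "discrete_holomorphic_on R z \<longleftrightarrow>
     (\<forall>i j. (i, j) \<in> R \<and> (i + 1, j) \<in> R \<and> (i + 1, j + 1) \<in> R \<and> (i, j + 1) \<in> R \<longrightarrow>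
        cross_ratio (z i j) (z (i + 1) j) (z (i + 1) (j + 1)) (z i (j + 1)) = -1)"

definition closed_on :: "(int \<times> int) set \<Rightarrow> nat \<Rightarrow> (int \<Rightarrow> int \<Rightarrow> csphere) \<Rightarrow> bool" where
  "closed_on R m z \<longleftrightarrow> (\<forall>i j. (i, j) \<in> R \<longrightarrow> z (i + int m) (j - int m) = z i j)"

definition strip :: "nat \<Rightarrow> (int \<times> int) set" where
  "strip N = {(i, j). 0 \<le> i + j \<and> i + j \<le> int N}"

text \<open>
  Rotated coordinates: \<open>rotated z (i - j) (i + j) = z i j\<close>. Only the values \<open>rotated z a b\<close> with
  \<open>a + b\<close> even are meaningful.
\<close>

definition rotated :: "(int \<Rightarrow> int \<Rightarrow> csphere) \<Rightarrow> int \<Rightarrow> int \<Rightarrow> csphere" where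
  "rotated z a b = z ((a + b) div 2) ((b - a) div 2)"

lemma rotated_eq: "rotated z (i - j) (i + j) = z i j"
  by (simp add: rotated_def)

section \<open>Propagation\<close>

text \<open>
  The row $\tilde z_k = (\tilde z_{a,k})_{a \equiv k}$ consists of the values on the antidiagonal
  \<open>i + j = k\<close>. It is indexed here by the first unrotated coordinate \<open>i\<close>, that is by
  \<open>i = (a + k) / 2\<close>, which ranges over all integers whatever the parity of \<open>k\<close>.
\<close>

type_synonym row = "int \<Rightarrow> csphere"

definition zrow :: "(int \<Rightarrow> int \<Rightarrow> csphere) \<Rightarrow> nat \<Rightarrow> row" where
  "zrow z k = (\<lambda>i. z i (int k - i))"

lemma zrow_rotated: "zrow z k i = rotated z (2 * i - int k) (int k)"
  by (simp add: zrow_def rotated_def)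

text \<open>
  One application of $T$ maps $(\tilde z_k, \tilde z_{k+1})$ to $(\tilde z_{k+1}, \tilde z_{k+2})$.
  It is partial: it is defined when each new value is uniquely determined by the cross-ratio
  relation on its quad. With \<open>u\<close>, \<open>v\<close> the rows \<open>k\<close>, \<open>k + 1\<close> and \<open>j = k + 1 - i\<close>, the quad is
  \<open>z (i - 1) j\<close>, \<open>z i j\<close>, \<open>z i (j + 1)\<close>, \<open>z (i - 1) (j + 1)\<close>.
\<close>

definition propagation :: "row \<times> row \<Rightarrow> (row \<times> row) option" where
  "propagation = (\<lambda>(u, v).
     if \<forall>i. \<exists>!w. cross_ratio (u (i - 1)) (v i) w (v (i - 1)) = -1
     then Some (v, \<lambda>i. THE w. cross_ratio (u (i - 1)) (v i) w (v (i - 1)) = -1)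
     else None)"

fun propagate :: "nat \<Rightarrow> row \<times> row \<Rightarrow> (row \<times> row) option" where
  "propagate 0 s = Some s"
| "propagate (Suc k) s = Option.bind (propagate k s) propagation"

end

theory Submission
  imports Defs
begin

text \<open>
  The cross-ratio equation with value $-1$ has a Lax pair in which an
  edge $p \to q$ acts on vectors $w \in \mathbb C[\lambda]^2$ by fixing the line $p$ and scaling
  the line $q$ by $1 \mp \lambda$ (sign according to the direction of the edge). The monodromy
  of the constant row 0 is triangular; besides the constant eigenvector it has an explicit
  polynomial eigenvector $w_i = (D, N_i)$. After division by $1 \mp \lambda$ the transported
  vector stays polynomial, and its degree drops by one every two rows. Degree 0 is reached in row
  $n$, which forces $w$ to be constant along row $n + 1$ and to span the lines
  $\tilde z_{i,n+1}$. At $\lambda = 0$ the transport is trivial, so that this line is spanned by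
  $w_i(0) = (m, \sum_\ell 1/\tilde z_{2\ell+1,1})$.
\<close>

section \<open>Polynomial vectors and their pairing with points of the sphere\<close>

type_synonym polyvec = "complex poly \<times> complex poly"

text \<open>The determinant of a lift of \<open>p\<close> and \<open>w\<close>; it vanishes exactly
  when \<open>w\<close> lies on the line \<open>p\<close>.\<close>

definition pairing :: "csphere \<Rightarrow> polyvec \<Rightarrow> complex poly" where
  "pairing p w = smult (fst (hcoords p)) (snd w) - smult (snd (hcoords p)) (fst w)"

lemma bracket_swap: "bracket b a = - bracket a b"
  by (simp add: bracket_def)

text \<open>The Plucker relation: three lifts in a plane are dependent, with brackets as
  coefficients; pair this dependency with \<open>w\<close>.\<close>

lemma pairing_three_term:
  "smult (bracket a b) (pairing c w) =
     smult (bracket c b) (pairing a w) + smult (bracket a c) (pairing b w)"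
  by (simp add: poly_eq_iff pairing_def bracket_def algebra_simps)

text \<open>Cramer's rule: pairings with two distinct points are coordinates on polynomial
  vectors.\<close>

lemma pairing_solve:
  assumes "bracket a b \<noteq> 0"
  obtains w where "pairing a w = f" "pairing b w = g"
proof
  define K where "K = bracket a b"
  define w where "w = (smult (fst (hcoords b)) f - smult (fst (hcoords a)) g,
                       smult (snd (hcoords b)) f - smult (snd (hcoords a)) g)"
  define w' where "w' = (smult (1 / K) (fst w), smult (1 / K) (snd w))"
  have scale: "pairing p w' = smult (1 / K) (pairing p w)" for p
    by (simp add: poly_eq_iff pairing_def w'_def algebra_simps)
  have "pairing a w = smult K f" "pairing b w = smult K g"
    by (simp_all add: poly_eq_iff pairing_def w_def K_def bracket_def algebra_simps)
  then show "pairing a w' = f" "pairing b w' = g"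
    using assms by (simp_all add: scale K_def)
qed

section \<open>The Lax pair on a single quad\<close>

text \<open>The lattice direction of the edge $p \to q$ is encoded by $\alpha = \pm 1$.\<close>

definition lax_edge :: "complex \<Rightarrow> csphere \<Rightarrow> csphere \<Rightarrow> polyvec \<Rightarrow> polyvec \<Rightarrow> bool" where
  "lax_edge \<alpha> p q w w' \<longleftrightarrow>
     pairing p w' = pairing p w \<and> [:1, -\<alpha>:] * pairing q w' = pairing q w"

text \<open>A zero denominator would make the quotient 0, not -1. For the diagonal
  \<open>bracket a b\<close>, the Plucker relation turns its product with \<open>bracket p r\<close>
  into twice a nonzero term.\<close>

lemma harmonic_nondegenerate:
  assumes "cross_ratio p a r b = -1"
  shows "bracket p a \<noteq> 0" "bracket p b \<noteq> 0" "bracket a r \<noteq> 0" "bracket a b \<noteq> 0"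
    "bracket p a * bracket r b = bracket a r * bracket p b"
proof -
  have nz: "bracket a r * bracket b p \<noteq> 0"
    using assms by (auto simp: cross_ratio_def)
  then have eq: "bracket p a * bracket r b = - (bracket a r * bracket b p)"
    using assms by (simp add: cross_ratio_def divide_eq_eq)
  then have nz': "bracket p a * bracket r b \<noteq> 0" using nz by simp
  show "bracket p a \<noteq> 0" "bracket p b \<noteq> 0" "bracket a r \<noteq> 0"
    using nz nz' bracket_swap[of b p] by auto
  show eq': "bracket p a * bracket r b = bracket a r * bracket p b"
    using eq bracket_swap[of b p] by simp
  have "bracket p r * bracket a b = bracket p a * bracket r b - bracket p b * bracket r a"
    by (simp add: bracket_def algebra_simps)
  also have "\<dots> = 2 * (bracket p a * bracket r b)"
    using eq' bracket_swap[of a r] by (simp add: algebra_simps)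
  finally show "bracket a b \<noteq> 0" using nz' by auto
qed

text \<open>The vector \<open>v\<close> is determined by the unscaled conditions on the two edges
  into \<open>r\<close>. Expanded in the points \<open>a\<close> and \<open>b\<close>, the remaining
  scaled condition reduces to \<open>harm\<close>.\<close>

lemma lax_edge_opposite:
  assumes nz: "bracket p a \<noteq> 0" "bracket a b \<noteq> 0"
    and harm: "bracket p a * bracket r b = bracket a r * bracket p b"
    and ea: "lax_edge \<alpha> p a w wa" and eb: "lax_edge (- \<alpha>) p b w wb"
    and v: "pairing a v = pairing a wa" "pairing b v = pairing b wb"
  shows "lax_edge (- \<alpha>) a r wa v"
proof -
  \<comment> \<open>Evaluation at \<open>t\<close> leaves an identity between complex numbers, which
    \<open>algebra\<close> can derive.\<close>
  have "poly ([:1, \<alpha>:] * pairing r v) t = poly (pairing r wa) t" for t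
  proof -
    define A B P R Y Z where "A = poly (pairing a wa) t" and "B = poly (pairing b wb) t"
      and "P = poly (pairing p w) t" and "R = poly (pairing r wa) t"
      and "Y = poly (pairing b wa) t" and "Z = poly (pairing r v) t"
    have ev: "bracket x y * poly (pairing c u) t =
        bracket c y * poly (pairing x u) t + bracket x c * poly (pairing y u) t" for x y c u
      using arg_cong[OF pairing_three_term[of x y c u], of "\<lambda>f. poly f t"] by simp
    have pa: "poly (pairing p wa) t = P"
      using ea by (simp add: lax_edge_def P_def)
    have "poly (pairing a w) t = poly ([:1, - \<alpha>:] * pairing a wa) t"
      "poly (pairing b w) t = poly ([:1, \<alpha>:] * pairing b wb) t"
      using ea eb by (simp_all only: lax_edge_def minus_minus)
    then have aw: "poly (pairing a w) t = (1 - \<alpha> * t) * A"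
      and bw: "poly (pairing b w) t = (1 + \<alpha> * t) * B"
      by (simp_all add: A_def B_def algebra_simps)
    have 1: "bracket a b * Z = bracket r b * A + bracket a r * B"
      using ev[of a b r v] v by (simp add: Z_def A_def B_def)
    have 2: "bracket a b * R = bracket r b * A + bracket a r * Y"
      using ev[of a b r wa] by (simp add: R_def A_def Y_def)
    \<comment> \<open>\<open>wa\<close> and \<open>w\<close> have the same pairing \<open>P\<close>
      with \<open>p\<close>; eliminating it expresses \<open>Y\<close>, and hence \<open>R\<close>,
      through \<open>A\<close> and \<open>B\<close>.\<close>
    have 3: "bracket p a * Y = - bracket a b * P + bracket p b * A"
      using ev[of p a b wa] pa bracket_swap[of b a] by (simp add: A_def Y_def)
    have 4: "bracket a b * P = bracket p b * ((1 - \<alpha> * t) * A) - bracket p a * ((1 + \<alpha> * t) * B)"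
      using ev[of a b p w] aw bw bracket_swap[of a p] by (simp add: P_def)
    have "bracket p a * bracket a b * ((1 + \<alpha> * t) * Z) = bracket p a * bracket a b * R"
      using 1 2 3 4 harm by algebra
    then have "(1 + \<alpha> * t) * Z = R" using nz by simp
    then show ?thesis by (simp add: Z_def R_def algebra_simps)
  qed
  then have "[:1, \<alpha>:] * pairing r v = pairing r wa"
    by (metis poly_eq_poly_eq_iff ext)
  then show ?thesis using v by (simp add: lax_edge_def)
qed

text \<open>Zero curvature: both paths from \<open>p\<close> to \<open>r\<close> transport
  \<open>w\<close> to the same vector. Opposite edges carry equal signs, so the second edge follows
  by exchanging \<open>a\<close> with \<open>b\<close> and \<alpha> with its negative.\<close>

lemma lax_quad:
  assumes cr: "cross_ratio p a r b = -1"
    and ea: "lax_edge \<alpha> p a w wa" and eb: "lax_edge (- \<alpha>) p b w wb"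
  obtains v where "lax_edge (- \<alpha>) a r wa v" "lax_edge \<alpha> b r wb v"
proof -
  note nd = harmonic_nondegenerate[OF cr]
  obtain v where v: "pairing a v = pairing a wa" "pairing b v = pairing b wb"
    using pairing_solve[OF nd(4)] by metis
  have "lax_edge (- \<alpha>) a r wa v"
    using lax_edge_opposite[OF nd(1,4,5) ea eb v] .
  moreover have "lax_edge (- (- \<alpha>)) b r wb v"
  proof (rule lax_edge_opposite[OF nd(2) _ _ eb _ v(2,1)])
    show "bracket b a \<noteq> 0" using nd(4) bracket_swap[of b a] by simp
    show "bracket p b * bracket r a = bracket b r * bracket p a"
      using nd(5) bracket_swap[of r a] bracket_swap[of r b] by algebra
    show "lax_edge (- (- \<alpha>)) p a w wa" using ea by simp
  qed
  ultimately show ?thesis using that by simp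
qed

section \<open>Degree bounds and values at 0 along an edge\<close>

text \<open>For \<open>d = 0\<close> this says \<open>f = 0\<close>, which
  \<open>degree f < d\<close> could not express; the last step of the degree descent relies on
  it.\<close>

definition deg_lt :: "nat \<Rightarrow> complex poly \<Rightarrow> bool" where
  "deg_lt d f \<longleftrightarrow> (\<forall>k\<ge>d. coeff f k = 0)"

definition deg_lt_vec :: "nat \<Rightarrow> polyvec \<Rightarrow> bool" where
  "deg_lt_vec d w \<longleftrightarrow> deg_lt d (fst w) \<and> deg_lt d (snd w)"

lemma deg_lt_pairing: "deg_lt_vec d w \<Longrightarrow> deg_lt d (pairing p w)"
  by (simp add: deg_lt_vec_def deg_lt_def pairing_def)

lemma vec_via_pairing:
  "smult (bracket p q) (fst w) =
     smult (fst (hcoords q)) (pairing p w) - smult (fst (hcoords p)) (pairing q w)"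
  "smult (bracket p q) (snd w) =
     smult (snd (hcoords q)) (pairing p w) - smult (snd (hcoords p)) (pairing q w)"
  by (simp_all add: poly_eq_iff pairing_def bracket_def algebra_simps)

text \<open>The vector is a combination of the two pairings with constant coefficients, so degree
  bounds carry over.\<close>

lemma deg_lt_vec_of_pairing:
  assumes "bracket p q \<noteq> 0" "deg_lt d (pairing p w)" "deg_lt d (pairing q w)"
  shows "deg_lt_vec d w"
proof -
  have "deg_lt d (smult (bracket p q) (fst w))" "deg_lt d (smult (bracket p q) (snd w))"
    using assms by (simp_all add: deg_lt_def vec_via_pairing)
  then show ?thesis using assms(1) by (simp add: deg_lt_vec_def deg_lt_def)
qed

lemma deg_lt_linear_factor:
  assumes "\<alpha> \<noteq> 0" "deg_lt (Suc d) ([:1, -\<alpha>:] * f)"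
  shows "deg_lt d f"
proof (cases "f = 0")
  case False
  have "degree ([:1, -\<alpha>:] * f) = Suc (degree f)"
    using assms(1) False by (subst degree_mult_eq) auto
  moreover have "coeff ([:1, -\<alpha>:] * f) (degree ([:1, -\<alpha>:] * f)) \<noteq> 0"
    using assms(1) False by (metis leading_coeff_0_iff mult_eq_0_iff neg_equal_0_iff_equal pCons_eq_0_iff)
  ultimately have "degree f < d"
    using assms(2) unfolding deg_lt_def by (metis Suc_le_mono not_le)
  then show ?thesis by (simp add: deg_lt_def coeff_eq_0)
qed (simp add: deg_lt_def)

lemma lax_edge_deg_lt_target:
  assumes "\<alpha> \<noteq> 0" "lax_edge \<alpha> p q w w'" "deg_lt (Suc d) (pairing q w)"
  shows "deg_lt d (pairing q w')"
  using assms deg_lt_linear_factor by (metis lax_edge_def)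

text \<open>The factor is 1 at \<lambda> = 0, so both pairings, which are coordinates there, are
  unchanged.\<close>

lemma lax_edge_at_0:
  assumes "bracket p q \<noteq> 0" "lax_edge \<alpha> p q w w'"
  shows "poly (fst w') 0 = poly (fst w) 0" "poly (snd w') 0 = poly (snd w) 0"
proof -
  have "poly (pairing q w') 0 = poly ([:1, -\<alpha>:] * pairing q w') 0" by simp
  then have q: "poly (pairing q w') 0 = poly (pairing q w) 0"
    using assms(2) by (simp only: lax_edge_def)
  have p: "poly (pairing p w') 0 = poly (pairing p w) 0"
    using assms(2) by (simp add: lax_edge_def)
  have "bracket p q * poly (fst w') 0 = bracket p q * poly (fst w) 0"
    "bracket p q * poly (snd w') 0 = bracket p q * poly (snd w) 0"
    using arg_cong[OF vec_via_pairing(1)[of p q w'], of "\<lambda>f. poly f 0"]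
      arg_cong[OF vec_via_pairing(1)[of p q w], of "\<lambda>f. poly f 0"]
      arg_cong[OF vec_via_pairing(2)[of p q w'], of "\<lambda>f. poly f 0"]
      arg_cong[OF vec_via_pairing(2)[of p q w], of "\<lambda>f. poly f 0"] p q by simp_all
  then show "poly (fst w') 0 = poly (fst w) 0" "poly (snd w') 0 = poly (snd w) 0"
    using assms(1) by simp_all
qed

section \<open>Transport from row to row\<close>

text \<open>The point \<open>v i\<close> is reached from \<open>u (i - 1)\<close> along the first
  lattice coordinate and from \<open>u i\<close> along the second; both edges must produce the same
  \<open>W' i\<close>.\<close>

definition lax_rows :: "row \<Rightarrow> row \<Rightarrow> (int \<Rightarrow> polyvec) \<Rightarrow> (int \<Rightarrow> polyvec) \<Rightarrow> bool" where
  "lax_rows u v W W' \<longleftrightarrow>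
     (\<forall>i. lax_edge 1 (u (i - 1)) (v i) (W (i - 1)) (W' i) \<and>
          lax_edge (- 1) (u i) (v i) (W i) (W' i))"

definition harmonic_rows :: "row \<Rightarrow> row \<Rightarrow> row \<Rightarrow> bool" where
  "harmonic_rows u v x \<longleftrightarrow>
     (\<forall>i. cross_ratio (u (i - 1)) (v i) (x i) (v (i - 1)) = -1)"

text \<open>Zero curvature on each quad extends compatible vectors by one row, so compatibility need
  only be verified on one initial pair of rows.\<close>

lemma lax_rows_step:
  assumes "harmonic_rows u v x" "lax_rows u v W W'"
  obtains W'' where "lax_rows v x W' W''"
proof -
  have "\<exists>y. lax_edge (- 1) (v i) (x i) (W' i) y \<and> lax_edge 1 (v (i - 1)) (x i) (W' (i - 1)) y" for i
    using assms lax_quad unfolding harmonic_rows_def lax_rows_def by metis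
  then obtain W'' where "\<forall>i. lax_edge (- 1) (v i) (x i) (W' i) (W'' i) \<and>
      lax_edge 1 (v (i - 1)) (x i) (W' (i - 1)) (W'' i)"
    by metis
  then show ?thesis using that by (auto simp: lax_rows_def)
qed

lemma harmonic_rows_nondegenerate:
  assumes "harmonic_rows u v x"
  shows "bracket (u i) (v i) \<noteq> 0" "bracket (v i) (x i) \<noteq> 0"
proof -
  have "cross_ratio (u i) (v (i + 1)) (x (i + 1)) (v i) = -1"
    using assms[unfolded harmonic_rows_def, rule_format, of "i + 1"] by simp
  then show "bracket (u i) (v i) \<noteq> 0" by (rule harmonic_nondegenerate(2))
  show "bracket (v i) (x i) \<noteq> 0"
    using assms harmonic_nondegenerate(3) unfolding harmonic_rows_def by metis
qed

text \<open>The first edge lowers the degree of the pairing with \<open>v i\<close> only. The second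
  keeps that pairing and lowers the one with \<open>x i\<close>; after two rows both coordinates
  have dropped.\<close>

lemma lax_rows_degree_drop:
  assumes h: "harmonic_rows u v x" and l: "lax_rows u v W W'" and l': "lax_rows v x W' W''"
    and deg: "\<And>i. deg_lt_vec (Suc d) (W i)"
  shows "deg_lt_vec d (W'' i)"
proof -
  have e: "lax_edge (- 1) (u i) (v i) (W i) (W' i)" and e': "lax_edge (- 1) (v i) (x i) (W' i) (W'' i)"
    using l l' by (auto simp: lax_rows_def)
  note nd = harmonic_rows_nondegenerate[OF h, of i]
  have v: "deg_lt d (pairing (v i) (W' i))"
    using lax_edge_deg_lt_target[OF _ e] deg_lt_pairing[OF deg] by simp
  then have "deg_lt (Suc d) (pairing (v i) (W' i))" by (simp add: deg_lt_def)
  moreover have "deg_lt (Suc d) (pairing (u i) (W' i))"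
    using e deg_lt_pairing[OF deg] by (simp add: lax_edge_def)
  ultimately have "deg_lt_vec (Suc d) (W' i)" using deg_lt_vec_of_pairing nd(1) by blast
  then have "deg_lt d (pairing (x i) (W'' i))"
    using lax_edge_deg_lt_target[OF _ e'] deg_lt_pairing by simp
  moreover have "deg_lt d (pairing (v i) (W'' i))"
    using e' v by (simp add: lax_edge_def)
  ultimately show ?thesis using deg_lt_vec_of_pairing nd(2) by blast
qed

definition at_0 :: "polyvec \<Rightarrow> complex \<times> complex" where
  "at_0 w = (poly (fst w) 0, poly (snd w) 0)"

lemma lax_rows_at_0:
  assumes "\<And>i. bracket (u i) (v i) \<noteq> 0" "lax_rows u v W W'"
  shows "at_0 (W' i) = at_0 (W i)"
  using assms lax_edge_at_0[of "u i" "v i" "- 1" "W i" "W' i"]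
  by (simp add: at_0_def lax_rows_def)

text \<open>Each unit of degree costs two rows, while the common value \<open>c\<close> at 0 is
  preserved; constants remain at the end.\<close>

lemma lax_rows_iterate:
  assumes h: "\<And>j. j < k + 2 * d \<Longrightarrow> harmonic_rows (x j) (x (j + 1)) (x (j + 2))"
    and l: "lax_rows (x k) (x (k + 1)) W W'"
    and deg: "\<And>i. deg_lt_vec (Suc d) (W i)" and c: "\<And>i. at_0 (W i) = c"
  shows "\<exists>V V'. lax_rows (x (k + 2 * d)) (x (k + 2 * d + 1)) V V' \<and>
           (\<forall>i. deg_lt_vec 1 (V i) \<and> at_0 (V i) = c)"
  using assms
proof (induction d arbitrary: k W W')
  case 0
  then show ?case by auto
next
  case (Suc d)
  have h0: "harmonic_rows (x k) (x (k + 1)) (x (k + 2))"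
    and h1: "harmonic_rows (x (k + 1)) (x (k + 2)) (x (k + 3))"
    using Suc.prems(1)[of k] Suc.prems(1)[of "k + 1"] by (simp_all add: numeral_3_eq_3)
  obtain W2 where W2: "lax_rows (x (k + 1)) (x (k + 2)) W' W2"
    using lax_rows_step[OF h0 Suc.prems(2)] .
  obtain W3 where W3: "lax_rows (x (k + 2)) (x (k + 3)) W2 W3"
    using lax_rows_step[OF h1 W2] .
  have "at_0 (W' i) = c" for i
    using lax_rows_at_0[OF harmonic_rows_nondegenerate(1)[OF h0] Suc.prems(2)] Suc.prems(4) by simp
  then have c2: "at_0 (W2 i) = c" for i
    using lax_rows_at_0[OF harmonic_rows_nondegenerate(2)[OF h0] W2] by simp
  have d2: "deg_lt_vec (Suc d) (W2 i)" for i
    by (rule lax_rows_degree_drop[OF h0 Suc.prems(2) W2]) (rule Suc.prems(3))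
  have "\<exists>V V'. lax_rows (x (k + 2 + 2 * d)) (x (k + 2 + 2 * d + 1)) V V' \<and>
           (\<forall>i. deg_lt_vec 1 (V i) \<and> at_0 (V i) = c)"
    by (rule Suc.IH[of "k + 2" W2 W3]) (use Suc.prems(1) W3 d2 c2 in \<open>simp_all add: numeral_3_eq_3\<close>)
  then show ?case by (simp add: algebra_simps)
qed

text \<open>A polynomial whose product with 1 + \<lambda> is constant must vanish. So
  \<open>V' i\<close> lies on the line \<open>v i\<close>, and its value at 0 is
  \<open>c\<close>.\<close>

lemma lax_rows_constant:
  assumes nd: "\<And>i. bracket (u i) (v i) \<noteq> 0" and l: "lax_rows u v V V'"
    and deg: "\<And>i. deg_lt_vec 1 (V i)" and c: "\<And>i. at_0 (V i) = c"
  shows "fst (hcoords (v i)) * snd c = snd (hcoords (v i)) * fst c"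
proof -
  have e: "lax_edge (- 1) (u i) (v i) (V i) (V' i)" using l by (simp add: lax_rows_def)
  have "deg_lt 0 (pairing (v i) (V' i))"
    using lax_edge_deg_lt_target[OF _ e, of 0] deg_lt_pairing[OF deg] by simp
  then have "pairing (v i) (V' i) = 0" by (simp add: deg_lt_def poly_eq_iff)
  then have "poly (pairing (v i) (V' i)) 0 = 0" by simp
  then show ?thesis
    using lax_rows_at_0[OF nd l, of i] c[of i] by (auto simp: pairing_def at_0_def)
qed

section \<open>The explicit initial vectors\<close>

definition basis_poly :: "nat \<Rightarrow> nat \<Rightarrow> complex poly" where
  "basis_poly k l = [:1, -1:] ^ l * [:1, 1:] ^ (k - l)"

lemma degree_basis_poly:
  assumes "l \<le> k" shows "degree (basis_poly k l) = k"
  using assms by (simp add: basis_poly_def degree_mult_eq degree_power_eq)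

lemma lead_coeff_basis_poly:
  assumes "l \<le> k" shows "coeff (basis_poly k l) k = (- 1) ^ l"
proof -
  have "lead_coeff (basis_poly k l) = (- 1) ^ l"
    by (simp add: basis_poly_def lead_coeff_mult lead_coeff_power)
  then show ?thesis using degree_basis_poly[OF assms] by simp
qed

lemma deg_lt_basis_sum:
  assumes "\<And>l. l \<in> A \<Longrightarrow> l \<le> k"
  shows "deg_lt (Suc k) (\<Sum>l\<in>A. smult (c l) (basis_poly k l))"
  using assms by (auto simp: deg_lt_def coeff_sum degree_basis_poly coeff_eq_0 intro!: sum.neutral)

text \<open>The leading coefficients alternate in sign, and for odd \<open>k\<close> their number is
  even, so they cancel.\<close>

lemma deg_lt_basis_sum_odd:
  assumes "odd k"
  shows "deg_lt k (\<Sum>l\<le>k. basis_poly k l)"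
proof -
  have "coeff (\<Sum>l\<le>k. basis_poly k l) k = (\<Sum>l\<le>k. (- 1) ^ l)"
    by (simp add: coeff_sum lead_coeff_basis_poly)
  also have "\<dots> = 0"
  proof -
    have "(\<Sum>l\<le>2 * r + 1. (- 1 :: complex) ^ l) = 0" for r
      by (induction r) simp_all
    then show ?thesis using assms by (metis oddE)
  qed
  finally have "coeff (\<Sum>l\<le>k. basis_poly k l) k = 0" .
  moreover have "deg_lt (Suc k) (\<Sum>l\<le>k. smult 1 (basis_poly k l))"
    by (rule deg_lt_basis_sum) simp
  ultimately show ?thesis by (simp add: deg_lt_def) (metis le_antisym not_less_eq_eq)
qed

lemma basis_poly_Suc:
  assumes "l \<le> k"
  shows "basis_poly (Suc k) l = [:1, 1:] * basis_poly k l"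
    "basis_poly (Suc k) (Suc l) = [:1, -1:] * basis_poly k l"
  using assms by (simp_all only: basis_poly_def Suc_diff_le power_Suc diff_Suc_Suc ac_simps)

text \<open>The line \<open>q\<close> is spanned by (1, \<open>a\<close>), including the case of
  infinite \<open>q\<close> with \<open>a = 0\<close>. This treats finite and infinite values
  uniformly.\<close>

lemma pairing_reciprocal:
  assumes "q \<noteq> Pt 0" "inverse q = Pt a"
  obtains c where "\<And>w. pairing q w = smult c (snd w - smult a (fst w))"
proof (cases q)
  case (Pt b)
  then have "b \<noteq> 0" "a = inverse b" using assms by auto
  then have "pairing q w = smult b (snd w - smult a (fst w))" for w
    by (simp add: Pt pairing_def smult_diff_right)
  then show ?thesis using that by blast
next
  case Infty
  then have "a = 0" using assms by simp
  then have "pairing q w = smult 1 (snd w - smult a (fst w))" for w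
    by (simp add: Infty pairing_def)
  then show ?thesis using that by blast
qed

text \<open>
  Up to a scalar, the vector \<open>(D, N i)\<close> on row 0 is the eigenvector of the monodromy for
  \<open>((1 - \<lambda>) / (1 + \<lambda>)) ^ m\<close>.
\<close>

lemma initial_lax_rows:
  fixes a :: "int \<Rightarrow> complex"
  defines "D \<equiv> \<lambda>k. \<Sum>l\<le>k. basis_poly k l"
  defines "N \<equiv> \<lambda>k i. \<Sum>l\<le>k. smult (a (i + 1 + int l)) (basis_poly k l)"
  defines "H \<equiv> \<lambda>k i. \<Sum>l\<le>k. smult (a (i + 1 + int l) - a i) (basis_poly k l)"
  assumes per: "\<And>i. a (i + int (Suc (Suc k))) = a i"
    and v: "\<And>i. v i \<noteq> Pt 0" "\<And>i. inverse (v i) = Pt (a i)"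
  shows "lax_rows (\<lambda>_. Pt 0) v (\<lambda>i. (D (Suc k), N (Suc k) i))
           (\<lambda>i. (D (Suc k), smult (a i) (D (Suc k)) + H k i))"
proof -
  have diff: "N (Suc k) i - smult s (D (Suc k)) =
      (\<Sum>l\<le>Suc k. smult (a (i + 1 + int l) - s) (basis_poly (Suc k) l))" for i s
    by (simp add: N_def D_def poly_eq_iff coeff_sum sum_distrib_left sum_subtractf left_diff_distrib
        del: sum.atMost_Suc)
  \<comment> \<open>The term \<open>l = Suc k\<close> vanishes by periodicity; all others contain
    the factor 1 + \<lambda>.\<close>
  have "N (Suc k) i - smult (a i) (D (Suc k)) =
      (\<Sum>l\<le>k. smult (a (i + 1 + int l) - a i) ([:1, 1:] * basis_poly k l))" for i
    unfolding diff using per[of i] by (simp add: basis_poly_Suc(1) algebra_simps del: mult_pCons_left)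
  then have up: "[:1, 1:] * H k i = N (Suc k) i - smult (a i) (D (Suc k))" for i
    by (simp only: H_def sum_distrib_left mult_smult_right)
  \<comment> \<open>Here the term \<open>l = 0\<close> vanishes, and after a shift of the index the
    others contain 1 - \<lambda>.\<close>
  have "N (Suc k) (i - 1) - smult (a i) (D (Suc k)) =
      (\<Sum>l\<le>k. smult (a (i + 1 + int l) - a i) ([:1, -1:] * basis_poly k l))" for i
    unfolding diff sum.atMost_Suc_shift
    by (simp add: basis_poly_Suc(2) algebra_simps del: mult_pCons_left)
  then have right: "[:1, -1:] * H k i = N (Suc k) (i - 1) - smult (a i) (D (Suc k))" for i
    by (simp only: H_def sum_distrib_left mult_smult_right)
  show ?thesis
    unfolding lax_rows_def lax_edge_def
  proof (intro allI conjI)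
    fix i
    obtain c where c: "\<And>w. pairing (v i) w = smult c (snd w - smult (a i) (fst w))"
      using pairing_reciprocal[OF v(1)[of i] v(2)[of i]] by metis
    show "[:1, - 1:] * pairing (v i) (D (Suc k), smult (a i) (D (Suc k)) + H k i) =
        pairing (v i) (D (Suc k), N (Suc k) (i - 1))"
      using right[of i] by (simp only: c fst_conv snd_conv add_diff_cancel_left' mult_smult_right)
    show "[:1, - (- 1):] * pairing (v i) (D (Suc k), smult (a i) (D (Suc k)) + H k i) =
        pairing (v i) (D (Suc k), N (Suc k) i)"
      using up[of i]
      by (simp only: c fst_conv snd_conv add_diff_cancel_left' mult_smult_right minus_minus)
  qed (simp_all add: pairing_def)
qed

section \<open>Collapse to the harmonic mean\<close>

lemma sum_periodic:
  fixes a :: "int \<Rightarrow> complex"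
  assumes "\<And>i. a (i + int (Suc k)) = a i"
  shows "(\<Sum>l\<le>k. a (i + int l)) = (\<Sum>l\<le>k. a (j + int l))"
proof -
  have step: "(\<Sum>l\<le>k. a (i + 1 + int l)) = (\<Sum>l\<le>k. a (i + int l))" for i
  proof -
    have "a i + (\<Sum>l\<le>k. a (i + 1 + int l)) = (\<Sum>l\<le>Suc k. a (i + int l))"
      by (simp only: sum.atMost_Suc_shift) (simp add: algebra_simps)
    also have "\<dots> = (\<Sum>l\<le>k. a (i + int l)) + a i"
      using assms[of i] by simp
    finally show ?thesis by simp
  qed
  have "(\<Sum>l\<le>k. a (i + int l)) = (\<Sum>l\<le>k. a (0 + int l))" for i
  proof (induction i rule: int_induct[of _ 0])
    case (step1 i)
    then show ?case using step[of i] by simp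
  next
    case (step2 i)
    then show ?case using step[of "i - 1"] by simp
  qed simp
  then show ?thesis by metis
qed

lemma sum_Pt: "(\<Sum>l\<in>A. Pt (f l)) = Pt (\<Sum>l\<in>A. f l)"
  by (induction A rule: infinite_finite_induct) (simp_all add: zero_csphere_def)

lemma harmonic_rows_collapse:
  fixes x :: "nat \<Rightarrow> row"
  assumes m: "m \<ge> 2" and n: "n = (if odd m then 2 * m - 2 else 2 * m - 3)"
    and h: "\<And>j. j < n \<Longrightarrow> harmonic_rows (x j) (x (j + 1)) (x (j + 2))"
    and x0: "\<And>i. x 0 i = Pt 0"
    and per: "\<And>i. x 1 (i + int m) = x 1 i"
  shows "x (n + 1) i =
           inverse (Pt (1 / of_nat m) * (\<Sum>l = 0..m - 1. inverse (x 1 (int l + 1))))"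
proof -
  obtain k where k: "m = Suc (Suc k)" using m by (metis add_2_eq_Suc le_Suc_ex)
  have n0: "n > 0" using m n by auto
  have h0: "harmonic_rows (x 0) (x 1) (x 2)" using h[OF n0] by (simp add: numeral_2_eq_2)
  \<comment> \<open>The first quads separate row 1 from row 0, so every reciprocal is
    finite.\<close>
  have nz: "x 1 i \<noteq> Pt 0" for i
    using harmonic_rows_nondegenerate(1)[OF h0, of i] x0[of i] by (auto simp: bracket_def)
  have "\<exists>b. inverse (x 1 i) = Pt b" for i
    using nz[of i] by (cases "x 1 i") auto
  then obtain a where a: "\<And>i. inverse (x 1 i) = Pt (a i)" by metis
  have aper: "a (i + int (Suc (Suc k))) = a i" for i
    using per[of i] a by (metis csphere.inject k)
  define D where "D = (\<Sum>l\<le>Suc k. basis_poly (Suc k) l)"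
  define N where "N = (\<lambda>i. \<Sum>l\<le>Suc k. smult (a (i + 1 + int l)) (basis_poly (Suc k) l))"
  define H where "H = (\<lambda>i. \<Sum>l\<le>k. smult (a (i + 1 + int l) - a i) (basis_poly k l))"
  define S where "S = (\<Sum>l\<le>Suc k. a (1 + int l))"
  define W where "W = (\<lambda>i. (D, N i))"
  define W' where "W' = (\<lambda>i. (D, smult (a i) D + H i))"
  have x0': "x 0 = (\<lambda>_. Pt 0)" using x0 by auto
  have l0: "lax_rows (x 0) (x 1) W W'"
    using initial_lax_rows[of a k "x 1", OF aper nz a] unfolding D_def N_def H_def W_def W'_def x0' .
  have S: "(\<Sum>l\<le>Suc k. a (i + 1 + int l)) = S" for i
    unfolding S_def by (rule sum_periodic[of a "Suc k"]) (rule aper)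
  have at0: "poly (basis_poly j l) 0 = 1" for j l
    by (simp add: basis_poly_def)
  \<comment> \<open>All basis polynomials equal 1 at 0: \<open>D\<close> contributes the number
    \<open>m\<close> of terms, \<open>N i\<close> a sum over one full period.\<close>
  have c0: "at_0 (W i) = (of_nat m, S)" for i
    using S[of i] by (simp add: W_def at_0_def D_def N_def poly_sum at0 k del: sum.atMost_Suc)
  have c1: "at_0 (W' i) = (of_nat m, S)" for i
    using lax_rows_at_0[OF harmonic_rows_nondegenerate(1)[OF h0] l0] c0 by simp
  have dD: "deg_lt m D"
    using deg_lt_basis_sum[of "{..Suc k}" "Suc k" "\<lambda>_. 1"] by (simp add: D_def k del: sum.atMost_Suc)
  have "\<exists>V V'. lax_rows (x n) (x (n + 1)) V V' \<and>
      (\<forall>i. deg_lt_vec 1 (V i) \<and> at_0 (V i) = (of_nat m, S))"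
  proof (cases "odd m")
    case True
    \<comment> \<open>For odd \<open>m\<close> the descent starts on row 0 from degree at most
      \<open>m - 1\<close>, which takes \<open>2 * (m - 1)\<close> rows.\<close>
    have "deg_lt_vec (Suc (Suc k)) (W i)" for i
      using dD deg_lt_basis_sum[of "{..Suc k}" "Suc k"]
      by (simp add: deg_lt_vec_def W_def N_def k del: sum.atMost_Suc)
    moreover have "n = 0 + 2 * Suc k" using True n k by simp
    ultimately show ?thesis
      using lax_rows_iterate[of 0 "Suc k" x W W' "(of_nat m, S)"] h l0 c0 by simp
  next
    case False
    \<comment> \<open>For even \<open>m\<close> the top coefficient of \<open>D\<close> cancels, so
      \<open>W'\<close> on row 1 already has degree at most \<open>m - 2\<close>. Starting there
      gives \<open>n = 1 + 2 * (m - 2)\<close>.\<close>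
    obtain W2 where W2: "lax_rows (x 1) (x 2) W' W2"
      using lax_rows_step[OF h0 l0] .
    have "deg_lt (Suc k) D"
      unfolding D_def using False k by (intro deg_lt_basis_sum_odd) simp
    moreover have "deg_lt (Suc k) (H i)" for i
      unfolding H_def by (intro deg_lt_basis_sum) simp
    ultimately have "deg_lt_vec (Suc k) (W' i)" for i
      by (simp add: deg_lt_vec_def W'_def deg_lt_def)
    moreover have "n = 1 + 2 * k" using False n k by simp
    ultimately show ?thesis
      using lax_rows_iterate[of 1 k x W' W2 "(of_nat m, S)"] h W2 c1 by (simp add: numeral_2_eq_2)
  qed
  then obtain V V' where V: "lax_rows (x n) (x (n + 1)) V V'"
    "\<And>i. deg_lt_vec 1 (V i)" "\<And>i. at_0 (V i) = (of_nat m, S)" by blast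
  have "bracket (x n i) (x (n + 1) i) \<noteq> 0" for i
    using harmonic_rows_nondegenerate(2)[OF h[of "n - 1"]] n0 by (simp add: numeral_2_eq_2)
  then have final: "fst (hcoords (x (n + 1) i)) * S = snd (hcoords (x (n + 1) i)) * of_nat m"
    using lax_rows_constant[OF _ V] by simp
  have m0: "of_nat m \<noteq> (0 :: complex)" using m by simp
  have "x (n + 1) i = inverse (Pt (1 / of_nat m) * Pt S)"
  proof (cases "x (n + 1) i")
    case (Pt b)
    then have bS: "b * S = of_nat m" using final by simp
    then have "S \<noteq> 0" using m0 by auto
    then show ?thesis using Pt bS m0 by (simp add: field_simps)
  next
    \<comment> \<open>An infinite value forces \<open>S = 0\<close>, in agreement with
      \<open>inverse (Pt 0) = Infty\<close>.\<close>
    case Infty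
    then show ?thesis using final by simp
  qed
  moreover have "(\<Sum>l = 0..m - 1. inverse (x 1 (int l + 1))) = Pt S"
    by (simp only: a sum_Pt S_def k diff_Suc_1 atMost_atLeast0 add.commute)
  ultimately show ?thesis by simp
qed

section \<open>From the lattice to rows\<close>

lemma harmonic_rows_zrow:
  assumes "discrete_holomorphic_on (strip N) z" "j + 2 \<le> N"
  shows "harmonic_rows (zrow z j) (zrow z (j + 1)) (zrow z (j + 2))"
  unfolding harmonic_rows_def
proof
  fix i
  have "cross_ratio (z (i - 1) (int j + 1 - i)) (z (i - 1 + 1) (int j + 1 - i))
      (z (i - 1 + 1) (int j + 1 - i + 1)) (z (i - 1) (int j + 1 - i + 1)) = -1"
    by (rule assms(1)[unfolded discrete_holomorphic_on_def, rule_format])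
      (use assms(2) in \<open>simp add: strip_def\<close>)
  then show "cross_ratio (zrow z j (i - 1)) (zrow z (j + 1) i) (zrow z (j + 2) i)
      (zrow z (j + 1) (i - 1)) = -1"
    by (simp add: zrow_def algebra_simps)
qed

theorem theorem6p11:
  fixes m n :: nat and z :: "int \<Rightarrow> int \<Rightarrow> csphere"
  assumes "m \<ge> 1"
    and "n = (if odd m then 2 * m - 2 else 2 * m - 3)"
    and "discrete_holomorphic_on (strip (n + 1)) z"
    and "closed_on (strip (n + 1)) m z"
    and "\<forall>i. even i \<longrightarrow> rotated z i 0 = 0"
    and "propagate n (zrow z 0, zrow z 1) = Some (zrow z n, zrow z (n + 1))"
  shows "\<forall>i. even (i + int n + 1) \<longrightarrow>
           rotated z i (int n + 1) =
             inverse (Pt (1 / of_nat m) * (\<Sum>l = 0..m - 1. inverse (rotated z (2 * int l + 1) 1)))"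
proof (intro allI impI)
  fix i :: int
  assume ev: "even (i + int n + 1)"
  have rot: "rotated z i (int n + 1) = zrow z (n + 1) ((i + int n + 1) div 2)"
  proof -
    have "(int n + 1 - i) div 2 = int n + 1 - (i + int n + 1) div 2"
      using ev by presburger
    then show ?thesis by (simp add: rotated_def zrow_def ac_simps)
  qed
  have rot1: "rotated z (2 * int l + 1) 1 = zrow z 1 (int l + 1)" for l
    by (simp add: zrow_rotated add.commute)
  have x0: "zrow z 0 i = Pt 0" for i
    using assms(5) by (simp add: zrow_rotated zero_csphere_def)
  have per: "zrow z 1 (i + int m) = zrow z 1 i" for i
    using assms(4)[unfolded closed_on_def, rule_format, of i "1 - i"]
    by (simp add: strip_def zrow_def algebra_simps)
  show "rotated z i (int n + 1) =
      inverse (Pt (1 / of_nat m) * (\<Sum>l = 0..m - 1. inverse (rotated z (2 * int l + 1) 1)))"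
  \<comment> \<open>For \<open>m = 1\<close> we have \<open>n = 0\<close>, and closedness makes row
    1 constant; the claim becomes that inversion is an involution, including at 0 and
    infinity.\<close>
  proof (cases "m = 1")
    case True
    have "zrow z 1 i = zrow z 1 1" for i
    proof (induction i rule: int_induct[of _ 1])
      case (step2 i)
      then show ?case using per[of "i - 1"] True by simp
    qed (use per True in simp_all)
    moreover have "inverse (Pt 1 * inverse y) = y" for y
      by (cases y) auto
    ultimately show ?thesis unfolding rot rot1 using True assms(2) by simp
  next
    case False
    show ?thesis unfolding rot rot1
    proof (rule harmonic_rows_collapse[where x = "zrow z", OF _ assms(2) _ x0 per])
      show "m \<ge> 2" using False assms(1) by simp
      show "harmonic_rows (zrow z j) (zrow z (j + 1)) (zrow z (j + 2))" if "j < n" for j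
        using harmonic_rows_zrow[OF assms(3)] that by simp
    qed
  qed
qed

end
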